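(* Let $X$ be a finite set and let $b\in\mathcal{P}(X)$. The Möbius function $\mu_{\leq_b}$ of $(\mathcal{P}(X),\leq_b)$ is given, for any $p_1$ and $p_2$ in $\mathcal{P}(X)$, by $$\mu_{\leq_b}(p_1,p_2)=\delta_{p_1\dashv_b p_1\wedge p_2}\ \delta_{p_1\wedge p_2\sqsupset_b p_2}\ \mu_f(p_1\wedge p_2,p_1)\ \mu_f(p_1\wedge p_2,p_2),$$ where for any partitions $q_1$ and $q_2$ such that $q_1$ is finer than $q_2$, $$\mu_f(q_1,q_2)=(-1)^{\mathrm{nc}(q_1)-\mathrm{nc}(q_2)}\prod_{i=3}^{\mathrm{nc}(q_1)}\big((i-1)!\big)^{r_i},$$ $r_i$ being the number of blocks of $q_2$ which contain exactly $i$ blocks of $q_1$.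
   Context: $\mathcal{P}(X)$ is the set of partitions of $X$; $\mathrm{nc}(p)$ is the number of blocks of $p$; $p$ is finer than $p'$ (equivalently $p'$ is coarser than $p$) if every block of $p$ is contained in a block of $p'$; $p\vee p'$ is the finest partition coarser than both $p$ and $p'$; $p\wedge p'$ is the coarsest partition finer than both $p$ and $p'$. The distance is $d(p,p')=\frac12(\mathrm{nc}(p)+\mathrm{nc}(p'))-\mathrm{nc}(p\vee p')$. For a base partition $b\in\mathcal{P}(X)$, the following are partial orders on $\mathcal{P}(X)$: - geodesic order: $p'\leq_b p$ if $d(b,p')+d(p',p)=d(b,p)$; - coarser-compatible order: $p'\dashv_b p$ if $p'$ is coarser than $p$ and $\mathrm{nc}(p'\vee b)=\mathrm{nc}(p\vee b)$; - finer-compatible order: $p'\sqsupset_b p$ if $p'$ is finer than $p$ and $\mathrm{nc}(p')-\mathrm{nc}(p'\vee b)=\mathrm{nc}(p)-\mathrm{nc}(p\vee b)$. $\delta_A$ equals $1$ if $A$ holds and $0$ otherwise. The Möbius function of a finite ordered set $(I,\leq)$ with order matrix $M_{x,y}=\delta_{y\leq x}$ is the function $\mu(x,y)=(M^{-1})_{y,x}$ on $I\times I$. *)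

theory Defs
  imports Complex_Main "HOL-Library.Disjoint_Sets"
begin

section \<open>The lattice of partitions of a set\<close>

text \<open>``\<open>p\<close> is finer than \<open>q\<close>'' is the library's \<open>refines X p q\<close>.\<close>

definition partitions :: "'a set \<Rightarrow> 'a set set set" where
  "partitions X = {p. partition_on X p}"

abbreviation nc :: "'a set set \<Rightarrow> nat" where
  "nc p \<equiv> card p"

definition pjoin :: "'a set \<Rightarrow> 'a set set \<Rightarrow> 'a set set \<Rightarrow> 'a set set" where
  "pjoin X p p' = (THE q. refines X p q \<and> refines X p' q \<and>
     (\<forall>r. refines X p r \<and> refines X p' r \<longrightarrow> refines X q r))"

definition pmeet :: "'a set \<Rightarrow> 'a set set \<Rightarrow> 'a set set \<Rightarrow> 'a set set" where
  "pmeet X p p' = (THE q. refines X q p \<and> refines X q p' \<and>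
     (\<forall>r. refines X r p \<and> refines X r p' \<longrightarrow> refines X r q))"

lemma pmeet_eq_common_refinement:
  assumes "partition_on X p" "partition_on X p'"
  shows "pmeet X p p' = common_refinement {p, p'}"
  unfolding pmeet_def
proof (rule the_equality)
  show *: "refines X (common_refinement {p, p'}) p \<and> refines X (common_refinement {p, p'}) p' \<and>
     (\<forall>r. refines X r p \<and> refines X r p' \<longrightarrow> refines X r (common_refinement {p, p'}))"
  proof (intro conjI allI impI)
    show "refines X (common_refinement {p, p'}) p" "refines X (common_refinement {p, p'}) p'"
      by (rule refines_common_refinement; use assms in auto)+
  next
    fix r assume "refines X r p \<and> refines X r p'"
    then show "refines X r (common_refinement {p, p'})"
      by (intro common_refinement_coarsest) (use assms in \<open>auto simp: refines_def\<close>)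
  qed
  show "q = common_refinement {p, p'}"
    if "refines X q p \<and> refines X q p' \<and> (\<forall>r. refines X r p \<and> refines X r p' \<longrightarrow> refines X r q)" for q
    using that * by (meson refines_asym)
qed

lemma pjoin_eq_common_refinement:
  assumes "partition_on X p" "partition_on X p'"
  shows "pjoin X p p' = common_refinement {r. refines X p r \<and> refines X p' r}" (is "_ = ?J")
    and "refines X p (pjoin X p p')" "refines X p' (pjoin X p p')"
    and "refines X p r \<Longrightarrow> refines X p' r \<Longrightarrow> refines X (pjoin X p p') r"
proof -
  let ?U = "{r. refines X p r \<and> refines X p' r}"
  let ?t = "if X = {} then {} else {X}"
  have "?t \<in> ?U"
    using assms by (auto simp: refines_def partition_on_space partition_on_empty dest: partition_onD1)
  then have ne: "?U \<noteq> {}" by blast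
  have up: "refines X p ?J" "refines X p' ?J"
    by (rule common_refinement_coarsest; use assms ne in \<open>auto simp: refines_def\<close>)+
  have least: "refines X ?J r" if "refines X p r" "refines X p' r" for r
    by (rule refines_common_refinement) (use that in \<open>auto simp: refines_def\<close>)
  show eq: "pjoin X p p' = ?J"
    unfolding pjoin_def
    by (rule the_equality) (use up least refines_asym in blast)+
  show "refines X p (pjoin X p p')" "refines X p' (pjoin X p p')"
    using up by (simp_all add: eq)
  show "refines X p r \<Longrightarrow> refines X p' r \<Longrightarrow> refines X (pjoin X p p') r"
    using least by (simp add: eq)
qed

definition pdist :: "'a set \<Rightarrow> 'a set set \<Rightarrow> 'a set set \<Rightarrow> real" where
  "pdist X p p' = (real (nc p) + real (nc p')) / 2 - real (nc (pjoin X p p'))"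


section \<open>The three orders with base partition \<open>b\<close>\<close>

text \<open>In each definition the arguments \<open>p' p\<close> are in the order of the infix notation,
  e.g. \<open>geodesic_le X b p' p\<close> is \<open>p' \<le>\<^sub>b p\<close>.\<close>

definition geodesic_le :: "'a set \<Rightarrow> 'a set set \<Rightarrow> 'a set set \<Rightarrow> 'a set set \<Rightarrow> bool" where
  "geodesic_le X b p' p \<longleftrightarrow> pdist X b p' + pdist X p' p = pdist X b p"

definition coarser_compat :: "'a set \<Rightarrow> 'a set set \<Rightarrow> 'a set set \<Rightarrow> 'a set set \<Rightarrow> bool" where
  "coarser_compat X b p' p \<longleftrightarrow> refines X p p' \<and> nc (pjoin X p' b) = nc (pjoin X p b)"

definition finer_compat :: "'a set \<Rightarrow> 'a set set \<Rightarrow> 'a set set \<Rightarrow> 'a set set \<Rightarrow> bool" where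
  "finer_compat X b p' p \<longleftrightarrow> refines X p' p \<and>
     int (nc p') - int (nc (pjoin X p' b)) = int (nc p) - int (nc (pjoin X p b))"


section \<open>The Moebius function of a finite ordered set\<close>

text \<open>Matrices with rows and columns indexed by a finite set \<open>I\<close> are functions \<open>'i \<Rightarrow> 'i \<Rightarrow> real\<close>
  of which only the entries in \<open>I \<times> I\<close> matter; the inverse is normalised to \<open>0\<close> elsewhere, which
  makes it unique.\<close>

definition is_inverse_matrix :: "'i set \<Rightarrow> ('i \<Rightarrow> 'i \<Rightarrow> real) \<Rightarrow> ('i \<Rightarrow> 'i \<Rightarrow> real) \<Rightarrow> bool" where
  "is_inverse_matrix I M N \<longleftrightarrow>
     (\<forall>x\<in>I. \<forall>y\<in>I. (\<Sum>z\<in>I. M x z * N z y) = of_bool (x = y)) \<and>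
     (\<forall>x\<in>I. \<forall>y\<in>I. (\<Sum>z\<in>I. N x z * M z y) = of_bool (x = y)) \<and>
     (\<forall>x y. x \<notin> I \<or> y \<notin> I \<longrightarrow> N x y = 0)"

definition inverse_matrix :: "'i set \<Rightarrow> ('i \<Rightarrow> 'i \<Rightarrow> real) \<Rightarrow> 'i \<Rightarrow> 'i \<Rightarrow> real" where
  "inverse_matrix I M = (THE N. is_inverse_matrix I M N)"

lemma inverse_matrix_eqI:
  assumes "finite I" "is_inverse_matrix I M N"
  shows "inverse_matrix I M = N"
  unfolding inverse_matrix_def
proof (rule the_equality)
  fix N' assume N': "is_inverse_matrix I M N'"
  have "N' x y = N x y" if xy: "x \<in> I" "y \<in> I" for x y
  proof -
    have "N' x y = (\<Sum>w\<in>I. N' x w * of_bool (w = y))"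
      using assms(1) xy by (simp add: of_bool_def if_distrib cong: if_cong)
    also have "\<dots> = (\<Sum>w\<in>I. N' x w * (\<Sum>z\<in>I. M w z * N z y))"
      using assms(2) xy by (intro sum.cong) (auto simp: is_inverse_matrix_def)
    also have "\<dots> = (\<Sum>z\<in>I. (\<Sum>w\<in>I. N' x w * M w z) * N z y)"
      unfolding sum_distrib_left sum_distrib_right
      by (subst sum.swap) (simp add: mult.assoc)
    also have "\<dots> = (\<Sum>z\<in>I. of_bool (x = z) * N z y)"
      using N' xy by (intro sum.cong) (auto simp: is_inverse_matrix_def)
    also have "\<dots> = N x y"
      using assms(1) xy by (subst sum.remove[of I x]) (auto intro!: sum.neutral)
    finally show ?thesis .
  qed
  then show "N' = N"
    using N' assms(2) unfolding is_inverse_matrix_def by (intro ext) metis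
qed (fact assms(2))

definition order_matrix :: "('i \<Rightarrow> 'i \<Rightarrow> bool) \<Rightarrow> 'i \<Rightarrow> 'i \<Rightarrow> real" where
  "order_matrix le x y = of_bool (le y x)"

definition moebius :: "'i set \<Rightarrow> ('i \<Rightarrow> 'i \<Rightarrow> bool) \<Rightarrow> 'i \<Rightarrow> 'i \<Rightarrow> real" where
  "moebius I le x y = inverse_matrix I (order_matrix le) y x"


section \<open>The function \<open>\<mu>\<^sub>f\<close>\<close>

definition block_count :: "'a set set \<Rightarrow> 'a set set \<Rightarrow> nat \<Rightarrow> nat" where
  "block_count q1 q2 i = card {B \<in> q2. card {C \<in> q1. C \<subseteq> B} = i}"

text \<open>Only meaningful when \<open>q1\<close> is finer than \<open>q2\<close>; then \<open>nc q2 \<le> nc q1\<close>, so the natural-number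
  subtraction in the exponent does not truncate.\<close>

definition mu_f :: "'a set set \<Rightarrow> 'a set set \<Rightarrow> real" where
  "mu_f q1 q2 = (-1) ^ (nc q1 - nc q2) * (\<Prod>i = 3..nc q1. fact (i - 1) ^ block_count q1 q2 i)"

end

theory Submission
  imports Defs
begin

text \<open>With \<open>j = p' \<or> p\<close>, the relation \<open>p' \<le>\<^sub>b p\<close> unfolds to the equality case of the sum of the
  two inequalities \<open>nc p' - nc (p' \<or> b) \<ge> nc j - nc (j \<or> b)\<close> (semimodularity) and
  \<open>nc (p \<or> b) \<ge> nc (j \<or> b)\<close>, that is, to \<open>p' \<sqsupset>\<^sub>b j\<close> and \<open>j \<stileturn>\<^sub>b p\<close>. The partition \<open>j\<close> is the
  only one between \<open>p'\<close> and \<open>p\<close> in this sense, so the matrix of \<open>\<le>\<^sub>b\<close> is a product of the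
  matrices of the two compatibility orders. Each of these is an interval-convex suborder of
  refinement or of its converse, so its Moebius function is the restriction of that of the
  partition lattice, \<open>\<mu>\<^sub>f\<close>. The product of the inverses, in the opposite order, is a sum over
  \<open>q\<close> with \<open>p\<^sub>1 \<stileturn>\<^sub>b q \<sqsupset>\<^sub>b p\<^sub>2\<close>, and the only possible such \<open>q\<close> is \<open>p\<^sub>1 \<and> p\<^sub>2\<close>.\<close>

section \<open>Refinement and semimodularity\<close>

lemma partition_on_block_eqI:
  assumes "partition_on X p" "A \<in> p" "B \<in> p" "x \<in> A" "x \<in> B"
  shows "A = B"
  using assms by (auto simp: partition_on_def disjoint_def)

section \<open>Counting the blocks of a finer partition inside a coarser block\<close>

definition subblocks :: "'a set set \<Rightarrow> 'a set \<Rightarrow> 'a set set" where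
  "subblocks p B = {C \<in> p. C \<subseteq> B}"

lemma finite_refines:
  assumes "finite X" "refines X p q"
  shows "finite p" "finite q"
  using assms finite_elements by (auto simp: refines_def)

lemma Union_subblocks: "refines X p q \<Longrightarrow> B \<in> q \<Longrightarrow> \<Union> (subblocks p B) = B"
  using refines_obtains_subset partition_onD1 by (fastforce simp: subblocks_def)

lemma card_subblocks_pos:
  assumes "finite X" "refines X p q" "B \<in> q"
  shows "0 < card (subblocks p B)"
proof -
  have "B \<noteq> {}" using assms by (auto simp: refines_def dest: partition_onD3)
  then have "subblocks p B \<noteq> {}" using Union_subblocks[OF assms(2,3)] by auto
  then show ?thesis
    using finite_refines[OF assms(1,2)] by (simp add: card_gt_0_iff subblocks_def)
qed

lemma subblocks_self:
  assumes "partition_on X p" "B \<in> p"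
  shows "subblocks p B = {B}"
proof -
  have "C = B" if "C \<in> p" "C \<subseteq> B" for C
    using that assms partition_onD3[OF assms(1)] partition_on_block_eqI[OF assms(1)]
    by (metis ex_in_conv subsetD)
  then show ?thesis using assms(2) by (auto simp: subblocks_def)
qed

lemma disjoint_subblocks:
  assumes "partition_on X p" "partition_on X q" "B \<in> q" "B' \<in> q" "B \<noteq> B'"
  shows "subblocks p B \<inter> subblocks p B' = {}"
proof -
  have "B \<inter> B' = {}" using assms(2-5) by (auto simp: partition_on_def disjoint_def)
  then have "C = {}" if "C \<subseteq> B" "C \<subseteq> B'" for C using that by blast
  then show ?thesis using partition_onD3[OF assms(1)] by (auto simp: subblocks_def)
qed

lemma sum_card_subblocks:
  assumes "finite X" "refines X p q"
  shows "(\<Sum>B\<in>q. card (subblocks p B)) = card p"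
proof -
  have "p = (\<Union>B\<in>q. subblocks p B)"
    using assms by (fastforce simp: subblocks_def refines_def)
  moreover have "card (\<Union>B\<in>q. subblocks p B) = (\<Sum>B\<in>q. card (subblocks p B))"
  proof (rule card_UN_disjoint)
    show "\<forall>B\<in>q. finite (subblocks p B)" using finite_refines[OF assms] by (simp add: subblocks_def)
    show "\<forall>B\<in>q. \<forall>B'\<in>q. B \<noteq> B' \<longrightarrow> subblocks p B \<inter> subblocks p B' = {}"
      using assms(2) disjoint_subblocks by (metis refines_def)
  qed (use finite_refines[OF assms] in simp)
  ultimately show ?thesis by simp
qed

lemma refines_card_le:
  assumes "finite X" "refines X p q"
  shows "card q \<le> card p"
proof -
  have "(\<Sum>B\<in>q. 1) \<le> (\<Sum>B\<in>q. card (subblocks p B))"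
    by (intro sum_mono) (use card_subblocks_pos[OF assms] in \<open>simp add: Suc_le_eq\<close>)
  then show ?thesis using sum_card_subblocks[OF assms] by simp
qed

lemma subblocks_eq_singletonD:
  assumes "refines X p q" "B \<in> q" "card (subblocks p B) = 1"
  shows "B \<in> p"
proof -
  obtain C where C: "subblocks p B = {C}" using assms(3) by (auto simp: card_1_singleton_iff)
  then have "C = B" using Union_subblocks[OF assms(1,2)] by simp
  then show ?thesis using C by (auto simp: subblocks_def)
qed

lemma refines_subset_eq:
  assumes "refines X p q" "q \<subseteq> p"
  shows "p = q"
  using assms by (metis refines_asym refines_def subsetD order_refl)

text \<open>\<open>card p\<close> is the sum, over the blocks of \<open>q\<close>, of the positive
  numbers of \<open>p\<close>-blocks they contain. If the sum is only \<open>card q\<close>, each of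
  these numbers is 1, so every block of \<open>q\<close> is a block of \<open>p\<close>.\<close>

lemma refines_card_eq:
  assumes "finite X" "refines X p q" "card p = card q"
  shows "p = q"
proof -
  have "card (subblocks p B) = 1" if "B \<in> q" for B
  proof (rule ccontr)
    assume "card (subblocks p B) \<noteq> 1"
    then have *: "1 < card (subblocks p B)"
      using card_subblocks_pos[OF assms(1,2) that] by linarith
    have "(\<Sum>B\<in>q. 1) < (\<Sum>B\<in>q. card (subblocks p B))"
      by (rule sum_strict_mono_ex1)
        (use * that finite_refines[OF assms(1,2)] card_subblocks_pos[OF assms(1,2)]
          in \<open>auto simp: Suc_le_eq\<close>)
    then show False using sum_card_subblocks[OF assms(1,2)] assms(3) by simp
  qed
  then have "q \<subseteq> p" using subblocks_eq_singletonD[OF assms(2)] by blast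
  then show ?thesis using refines_subset_eq[OF assms(2)] by blast
qed

text \<open>Supplies the block on which the later inductions act: two of its sub-blocks are merged
  for semimodularity, and one of them is detached for the sum of \<open>mu_f\<close>.\<close>

lemma refines_neq_ex_block:
  assumes "finite X" "refines X p q" "p \<noteq> q"
  shows "\<exists>B\<in>q. 2 \<le> card (subblocks p B)"
proof (rule ccontr)
  assume *: "\<not> (\<exists>B\<in>q. 2 \<le> card (subblocks p B))"
  have "card (subblocks p B) = 1" if "B \<in> q" for B
    using card_subblocks_pos[OF assms(1,2) that] that * by force
  then have "q \<subseteq> p" using subblocks_eq_singletonD[OF assms(2)] by blast
  then show False using refines_subset_eq[OF assms(2)] assms(3) by blast
qed

section \<open>Merging two blocks\<close>

definition merge :: "'a set set \<Rightarrow> 'a set \<Rightarrow> 'a set \<Rightarrow> 'a set set" where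
  "merge r A B = insert (A \<union> B) (r - {A, B})"

lemma refines_merge_right:
  assumes "partition_on X r" "A \<in> r" "B \<in> r"
  shows "refines X r (merge r A B)"
proof -
  have "partition_on X (merge r A B)"
  proof (rule partition_onI)
    show "\<Union> (merge r A B) = X" using assms by (auto simp: merge_def partition_on_def)
    show "{} \<notin> merge r A B" using assms by (auto simp: merge_def partition_on_def)
    show "disjnt C D" if "C \<in> merge r A B" "D \<in> merge r A B" "C \<noteq> D" for C D
      using that assms by (auto simp: merge_def partition_on_def disjoint_def disjnt_def)
  qed
  then show ?thesis using assms by (auto simp: refines_def merge_def)
qed

lemma refines_merge_left:
  assumes "refines X r p" "C \<in> p" "A \<in> r" "B \<in> r" "A \<subseteq> C" "B \<subseteq> C"
  shows "refines X (merge r A B) p"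
  using assms refines_merge_right[of X r A B] by (auto simp: refines_def merge_def)

lemma union_notin_partition:
  assumes "partition_on X r" "A \<in> r" "B \<in> r" "A \<noteq> B"
  shows "A \<union> B \<notin> r"
proof
  assume "A \<union> B \<in> r"
  moreover obtain x y where "x \<in> A" "y \<in> B" using assms partition_onD3 by (metis ex_in_conv)
  ultimately have "A = A \<union> B" "B = A \<union> B"
    using assms partition_on_block_eqI by (metis UnI1 UnI2)+
  then show False using assms(4) by simp
qed

lemma card_merge:
  assumes "finite X" "partition_on X r" "A \<in> r" "B \<in> r" "A \<noteq> B"
  shows "Suc (card (merge r A B)) = card r"
proof -
  have fin: "finite r" using assms finite_elements by blast
  have "card r \<ge> 2" using card_mono[OF fin, of "{A,B}"] assms by simp
  then show ?thesis
    unfolding merge_def using fin union_notin_partition[OF assms(2-5)] assms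
    by (simp add: card_Diff_subset)
qed

lemma pjoin_commute: "pjoin X p q = pjoin X q p"
  unfolding pjoin_def by (simp add: conj_commute conj_left_commute)

lemma pjoin_mono:
  assumes "refines X p q" "partition_on X b"
  shows "refines X (pjoin X p b) (pjoin X q b)"
  using assms by (meson pjoin_eq_common_refinement refines_def refines_trans)

text \<open>By induction on a chain of merges from \<open>q\<close> to \<open>m\<close>: merging two blocks of \<open>q\<close> lowers
  the number of blocks of \<open>q \<or> b\<close> by at most one.\<close>

lemma refines_join_semimodular:
  assumes "finite X" "partition_on X b" "refines X q m"
  shows "card m + card (pjoin X q b) \<le> card q + card (pjoin X m b)"
  using assms(3)
proof (induction "card q" arbitrary: q)
  case 0
  then have "q = m" using refines_card_le[OF assms(1), of q m] refines_card_eq[OF assms(1)] by simp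
  then show ?case by simp
next
  case (Suc n)
  show ?case
  proof (cases "q = m")
    case False
    then obtain C where C: "C \<in> m" "2 \<le> card (subblocks q C)"
      using refines_neq_ex_block[OF assms(1) Suc.prems] by blast
    then obtain A B where AB: "A \<in> subblocks q C" "B \<in> subblocks q C" "A \<noteq> B"
      by (metis card_2_iff' card_le_Suc0_iff_eq card.infinite not_less_eq_eq numeral_2_eq_2 zero_le)
    then have AB': "A \<in> q" "B \<in> q" "A \<subseteq> C" "B \<subseteq> C" by (auto simp: subblocks_def)
    have pq: "partition_on X q" using Suc.prems by (simp add: refines_def)
    let ?q = "merge q A B" and ?J = "pjoin X q b"
    have qJ: "refines X q ?J" "refines X b ?J"
      using pjoin_eq_common_refinement[OF pq assms(2)] by auto
    \<comment> \<open>The blocks of the join that contain \<open>A\<close> and \<open>B\<close>.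
      Merging them gives a common coarsening of \<open>b\<close> and of \<open>q\<close> with
      \<open>A\<close> and \<open>B\<close> merged, hence a partition coarser than the new
      join.\<close>
    obtain A' B' where J: "A' \<in> ?J" "B' \<in> ?J" "A \<subseteq> A'" "B \<subseteq> B'"
      using qJ(1) AB' unfolding refines_def by meson
    have pJ: "partition_on X ?J" using qJ by (simp add: refines_def)
    have pq': "partition_on X ?q" using refines_merge_right[OF pq AB'(1,2)] by (simp add: refines_def)
    have JJ: "refines X ?J (merge ?J A' B')" by (rule refines_merge_right[OF pJ J(1,2)])
    have "refines X ?q (merge ?J A' B')"
      using refines_merge_left[OF refines_trans[OF qJ(1) JJ], of "A' \<union> B'" A B] J AB'
      by (auto simp: merge_def)
    then have "refines X (pjoin X ?q b) (merge ?J A' B')"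
      using refines_trans[OF qJ(2) JJ] pjoin_eq_common_refinement(4)[OF pq' assms(2)] by blast
    then have 1: "card (merge ?J A' B') \<le> card (pjoin X ?q b)"
      by (rule refines_card_le[OF assms(1)])
    \<comment> \<open>If \<open>A\<close> and \<open>B\<close> already lie in one block of the join,
      then \<open>A' = B'\<close> and the merge changes nothing; otherwise it costs exactly one
      block.\<close>
    have 2: "card ?J \<le> Suc (card (merge ?J A' B'))"
    proof (cases "A' = B'")
      case True
      then have "merge ?J A' B' = ?J" using J by (auto simp: merge_def)
      then show ?thesis by simp
    next
      case False
      then show ?thesis using card_merge[OF assms(1) pJ J(1,2)] by simp
    qed
    have 3: "Suc (card ?q) = card q" by (rule card_merge[OF assms(1) pq AB'(1,2) AB(3)])
    have "card m + card (pjoin X ?q b) \<le> card ?q + card (pjoin X m b)"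
      using Suc.hyps 3 refines_merge_left[OF Suc.prems C(1) AB'] by simp
    then show ?thesis using 1 2 3 by linarith
  qed simp
qed

section \<open>The Moebius function of the partition lattice\<close>

definition interval :: "'a set \<Rightarrow> 'a set set \<Rightarrow> 'a set set \<Rightarrow> 'a set set set" where
  "interval X q p = {r. refines X q r \<and> refines X r p}"

lemma finite_interval: "finite X \<Longrightarrow> finite (interval X q p)"
  by (rule finite_subset[OF _ finitely_many_partition_on]) (auto simp: interval_def refines_def)

text \<open>For positive \<open>k\<close> this is the Moebius value, in the lattice of partitions of
  a set of \<open>k\<close> elements, from the partition into singletons to the one-block
  partition.\<close>

definition block_weight :: "nat \<Rightarrow> real" where
  "block_weight k = (-1) ^ (k - 1) * fact (k - 1)"

lemma block_weight_Suc: "0 < k \<Longrightarrow> block_weight (Suc k) = - real k * block_weight k"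
  by (cases k) (auto simp: block_weight_def algebra_simps)

text \<open>A block of \<open>r\<close> containing \<open>k\<close> blocks of \<open>q\<close>
  contributes \<open>k - 1\<close> to the exponent of the sign and one factor
  \<open>fact (k - 1)\<close>; \<open>block_count\<close> merely groups the blocks by
  \<open>k\<close>. The product form is the one that can be followed through merging two
  blocks.\<close>

lemma mu_f_eq_prod:
  assumes "finite X" "refines X q r"
  shows "mu_f q r = (\<Prod>B\<in>r. block_weight (card (subblocks q B)))"
proof -
  let ?k = "\<lambda>B. card (subblocks q B)"
  have fin: "finite q" "finite r" using finite_refines[OF assms] by auto
  have pos: "0 < ?k B" if "B \<in> r" for B using card_subblocks_pos[OF assms that] .
  have bc: "block_count q r i = card {B \<in> r. ?k B = i}" for i
    by (simp add: block_count_def subblocks_def)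
  have "(\<Sum>B\<in>r. ?k B - 1) = (\<Sum>B\<in>r. ?k B) - (\<Sum>B\<in>r. 1)"
    by (rule sum_subtractf_nat) (use pos in \<open>auto simp: Suc_le_eq\<close>)
  then have "(-1) ^ (card q - card r) = (\<Prod>B\<in>r. (-1::real) ^ (?k B - 1))"
    by (simp add: sum_card_subblocks[OF assms] flip: power_sum)
  moreover have "(\<Prod>i = 3..card q. fact (i - 1) ^ block_count q r i) = (\<Prod>B\<in>r. fact (?k B - 1) :: real)"
  proof -
    \<comment> \<open>Extending the range down to 0 lets the fibres over \<open>i\<close> cover all
      blocks of \<open>r\<close>. The added factors are powers of \<open>fact 0\<close> or
      \<open>fact 1\<close>, since \<open>0 - 1 = 0\<close> on naturals.\<close>
    have "(\<Prod>i = 3..card q. fact (i - 1) ^ block_count q r i) =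
        (\<Prod>i\<in>{0..card q}. fact (i - 1) ^ block_count q r i :: real)"
    proof (rule prod.mono_neutral_left)
      show "\<forall>i\<in>{0..card q} - {3..card q}. fact (i - 1) ^ block_count q r i = (1::real)"
      proof
        fix i assume "i \<in> {0..card q} - {3..card q}"
        then have "i = 0 \<or> i = 1 \<or> i = 2" by auto
        then show "fact (i - 1) ^ block_count q r i = (1::real)" by auto
      qed
    qed auto
    also have "\<dots> = (\<Prod>i\<in>{0..card q}. \<Prod>B\<in>{B \<in> r. ?k B = i}. fact (?k B - 1))"
      by (rule prod.cong) (auto simp: bc)
    also have "\<dots> = (\<Prod>B\<in>r. fact (?k B - 1))"
      by (rule prod.group) (use fin in \<open>auto simp: subblocks_def intro: card_mono\<close>)
    finally show ?thesis .
  qed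
  ultimately show ?thesis
    by (simp add: mu_f_def block_weight_def prod.distrib)
qed

section \<open>Detaching a subset from a block\<close>

definition split_block :: "'a set set \<Rightarrow> 'a set \<Rightarrow> 'a set \<Rightarrow> 'a set set" where
  "split_block p C Q = insert Q (insert (C - Q) (p - {C}))"

lemma refines_split_block_right:
  assumes "partition_on X p" "C \<in> p" "Q \<subset> C" "Q \<noteq> {}"
  shows "refines X (split_block p C Q) p"
proof -
  have "partition_on X (split_block p C Q)"
  proof (rule partition_onI)
    show "\<Union> (split_block p C Q) = X" using assms by (auto simp: split_block_def partition_on_def)
    show "{} \<notin> split_block p C Q" using assms by (auto simp: split_block_def partition_on_def)
    have "D \<inter> C = {}" if "D \<in> p" "D \<noteq> C" for D
      using that assms by (auto simp: partition_on_def disjoint_def)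
    then have *: "disjnt D C" "disjnt C D" if "D \<in> p" "D \<noteq> C" for D
      using that by (auto simp: disjnt_def)
    then have **: "disjnt D Q" "disjnt Q D" "disjnt D (C - Q)" "disjnt (C - Q) D" if "D \<in> p" "D \<noteq> C" for D
      using that assms(3) by (fastforce simp: disjnt_iff)+
    show "disjnt A B" if "A \<in> split_block p C Q" "B \<in> split_block p C Q" "A \<noteq> B" for A B
    proof -
      have "disjnt Q (C - Q)" "disjnt (C - Q) Q" by (auto simp: disjnt_def)
      moreover have "disjnt A B" if "A \<in> p" "B \<in> p" "A \<noteq> B" for A B
        using that partition_onD2[OF assms(1)] by (auto simp: pairwise_def disjnt_def)
      ultimately show ?thesis using that ** unfolding split_block_def by blast
    qed
  qed
  then show ?thesis using assms by (auto simp: refines_def split_block_def)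
qed

text \<open>Every other block of \<open>r\<close> is disjoint from \<open>Q\<close>, so one that
  lies in \<open>C\<close> lies in \<open>C - Q\<close>.\<close>

lemma refines_split_block_left:
  assumes "refines X r p" "C \<in> p" "Q \<subset> C" "Q \<in> r"
  shows "refines X r (split_block p C Q)"
proof -
  have pr: "partition_on X r" "partition_on X p" using assms by (auto simp: refines_def)
  have "Q \<noteq> {}" using assms(4) pr partition_onD3 by blast
  then have s: "partition_on X (split_block p C Q)"
    using refines_split_block_right[OF pr(2) assms(2,3)] by (simp add: refines_def)
  have "\<exists>E\<in>split_block p C Q. D \<subseteq> E" if D: "D \<in> r" for D
  proof -
    obtain E where E: "E \<in> p" "D \<subseteq> E" using D assms(1) by (auto simp: refines_def)
    have "D = Q \<or> D \<inter> Q = {}" using D assms(4) pr by (auto simp: partition_on_def disjoint_def)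
    then show ?thesis using E by (cases "E = C") (auto simp: split_block_def)
  qed
  then show ?thesis using pr s by (auto simp: refines_def)
qed


text \<open>Restricts a refinement to a block \<open>E\<close>, so that
  \<open>sum_card_subblocks\<close> can be applied inside \<open>E\<close>; the use below is with
  \<open>E = C - Q\<close>.\<close>

lemma refines_subblocks:
  assumes "refines X q r" "refines X r p" "E \<in> p"
  shows "refines E (subblocks q E) (subblocks r E)"
proof -
  have qp: "refines X q p" using assms refines_trans by blast
  have "\<exists>Y\<in>subblocks r E. D \<subseteq> Y" if D: "D \<in> subblocks q E" for D
  proof -
    have "D \<noteq> {}" using D assms(1) partition_onD3 by (auto simp: subblocks_def refines_def)
    then obtain x where x: "x \<in> D" "x \<in> E" using D by (auto simp: subblocks_def)
    obtain Y where Y: "Y \<in> r" "D \<subseteq> Y" using D assms(1) by (auto simp: subblocks_def refines_def)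
    obtain E' where E': "E' \<in> p" "Y \<subseteq> E'" using Y assms(2) by (auto simp: refines_def)
    have "E' = E"
      using partition_on_block_eqI[of X p E' E x] assms(2,3) E' Y x by (auto simp: refines_def)
    then show ?thesis using Y E' by (auto simp: subblocks_def)
  qed
  then show ?thesis
    using refines_obtains_subset[OF qp assms(3)] refines_obtains_subset[OF assms(2,3)]
    by (simp add: refines_def subblocks_def)
qed

section \<open>Recursion over a block \<open>Q\<close> of \<open>q\<close> lying properly inside a
  block \<open>C\<close> of \<open>p\<close>\<close>

context
  fixes X :: "'a set" and q p :: "'a set set" and C Q :: "'a set"
  assumes fin: "finite X" and qp: "refines X q p"
    and C: "C \<in> p" and Q: "Q \<in> q" "Q \<subset> C"
begin

lemma Q_nonempty: "Q \<noteq> {}"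
  using Q(1) qp partition_onD3 by (auto simp: refines_def)

lemma refines_splits: "refines X q (split_block p C Q)" "refines X (split_block p C Q) p"
proof -
  show "refines X q (split_block p C Q)" using refines_split_block_left[OF qp C Q(2,1)] .
  show "refines X (split_block p C Q) p"
    using refines_split_block_right[OF _ C Q(2) Q_nonempty, of X] qp
    unfolding refines_def by blast
qed

text \<open>The block of \<open>r\<close> containing \<open>Q\<close> must fit into a block of
  \<open>split_block p C Q\<close>, and the only one meeting \<open>Q\<close> is \<open>Q\<close>
  itself. Conversely, a partition below \<open>p\<close> with \<open>Q\<close> as a block is below
  the split one.\<close>

lemma interval_split_block:
  "interval X q (split_block p C Q) = {r \<in> interval X q p. Q \<in> r}"
proof (intro equalityI subsetI)
  fix r assume r: "r \<in> interval X q (split_block p C Q)"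
  then have r': "refines X q r" "refines X r (split_block p C Q)" by (auto simp: interval_def)
  obtain D where D: "D \<in> r" "Q \<subseteq> D" using r' Q(1) unfolding refines_def by blast
  obtain E where E: "E \<in> split_block p C Q" "D \<subseteq> E" using r' D unfolding refines_def by blast
  obtain x where "x \<in> Q" using Q_nonempty by auto
  then have "E = Q"
    using E D r'(2) by (intro partition_on_block_eqI[of X "split_block p C Q" E Q x])
      (auto simp: refines_def split_block_def)
  then show "r \<in> {r \<in> interval X q p. Q \<in> r}"
    using D E r' refines_trans[OF r'(2) refines_splits(2)] by (auto simp: interval_def)
next
  fix r assume "r \<in> {r \<in> interval X q p. Q \<in> r}"
  then show "r \<in> interval X q (split_block p C Q)"
    using refines_split_block_left[of X r p C Q] C Q by (auto simp: interval_def)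
qed

lemma Q_disjoint:
  assumes "r \<in> interval X q p" "Q \<in> r" "B \<in> subblocks r (C - Q)"
  shows "B \<in> r" "B \<inter> Q = {}" "B \<noteq> {}" "B \<noteq> Q" "B \<subseteq> C"
proof -
  show B: "B \<in> r" "B \<inter> Q = {}" "B \<subseteq> C" using assms(3) by (auto simp: subblocks_def)
  show "B \<noteq> {}" using B(1) assms(1) partition_onD3[of X r] by (auto simp: interval_def refines_def)
  then show "B \<noteq> Q" using B(2) by auto
qed

text \<open>A partition in \<open>[q, p]\<close> either has \<open>Q\<close> as a block or becomes such a partition, in a
  unique way, when \<open>Q\<close> is detached from its block. The weights of the partitions obtained by
  reattaching \<open>Q\<close> to a block \<open>B\<close> add up to a multiple of the original weight that depends
  only on the number of \<open>q\<close>-blocks in \<open>C\<close>.\<close>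

lemma interval_merge_decomposition:
  defines "S \<equiv> interval X q (split_block p C Q)"
  defines "T \<equiv> (SIGMA r:S. subblocks r (C - Q))"
  shows "interval X q p = S \<union> (\<lambda>(r, B). merge r Q B) ` T"
    and "S \<inter> (\<lambda>(r, B). merge r Q B) ` T = {}"
    and "inj_on (\<lambda>(r, B). merge r Q B) T"
proof -
  have S: "r \<in> S \<longleftrightarrow> r \<in> interval X q p \<and> Q \<in> r" for r
    unfolding S_def interval_split_block by simp
  have m1: "merge r Q B \<in> interval X q p" if "r \<in> S" "B \<in> subblocks r (C - Q)" for r B
  proof -
    have r: "r \<in> interval X q p" "Q \<in> r" using that S by auto
    note B = Q_disjoint[OF r that(2)]
    have "refines X r (merge r Q B)" using refines_merge_right r B by (auto simp: interval_def refines_def)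
    moreover have "refines X (merge r Q B) p"
      by (rule refines_merge_left[OF _ C]) (use r B Q in \<open>auto simp: interval_def\<close>)
    ultimately show ?thesis using r refines_trans by (auto simp: interval_def)
  qed
  \<comment> \<open>The preimage of \<open>s\<close> is found by detaching \<open>Q\<close> from the
    block \<open>D\<close> of \<open>s\<close> that contains it, with
    \<open>B = D - Q\<close>.\<close>
  have m2: "\<exists>(r, B)\<in>T. s = merge r Q B" if s: "s \<in> interval X q p" "Q \<notin> s" for s
  proof -
    have s': "refines X q s" "refines X s p" using s by (auto simp: interval_def)
    obtain D where D: "D \<in> s" "Q \<subseteq> D" using s' Q(1) unfolding refines_def by blast
    then have QD: "Q \<subset> D" using s(2) by auto
    obtain E where E: "E \<in> p" "D \<subseteq> E" using s' D unfolding refines_def by blast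
    obtain x where "x \<in> Q" using Q_nonempty by auto
    then have "E = C"
      using E D C Q qp by (intro partition_on_block_eqI[of X p E C x]) (auto simp: refines_def)
    then have DC: "D \<subseteq> C" using E by simp
    let ?r = "split_block s D Q"
    have "refines X q ?r" using refines_split_block_left[OF s'(1) D(1) QD Q(1)] .
    moreover have "refines X ?r s"
      using refines_split_block_right[of X s D Q] s' D QD Q_nonempty by (auto simp: refines_def)
    ultimately have "?r \<in> S" using refines_trans[OF _ s'(2)] by (auto simp: S interval_def split_block_def)
    moreover have "D - Q \<in> subblocks ?r (C - Q)"
      using DC by (auto simp: subblocks_def split_block_def)
    moreover have "s = merge ?r Q (D - Q)"
    proof -
      \<comment> \<open>\<open>merge\<close> deletes \<open>Q\<close> and \<open>D - Q\<close> from
        the split partition; neither may be an original block of \<open>s\<close>, or it would be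
        lost.\<close>
      have "D - Q \<notin> s"
      proof
        assume "D - Q \<in> s"
        moreover obtain y where "y \<in> D - Q" using QD by auto
        ultimately have "D - Q = D"
          using D s' by (intro partition_on_block_eqI[of X s "D - Q" D y]) (auto simp: refines_def)
        then show False using QD Q_nonempty by auto
      qed
      moreover have "Q \<union> D = D" using QD by auto
      ultimately show ?thesis
        using D QD s(2) by (auto simp: merge_def split_block_def)
    qed
    ultimately show ?thesis by (auto simp: T_def)
  qed
  have m3: "Q \<notin> merge r Q B" if "r \<in> S" "B \<in> subblocks r (C - Q)" for r B
  proof -
    have "r \<in> interval X q p" "Q \<in> r" using that S by auto
    note B = Q_disjoint[OF this that(2)]
    show ?thesis using B by (auto simp: merge_def)
  qed
  show "interval X q p = S \<union> (\<lambda>(r, B). merge r Q B) ` T"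
  proof (intro equalityI subsetI)
    fix s assume "s \<in> interval X q p"
    then show "s \<in> S \<union> (\<lambda>(r, B). merge r Q B) ` T"
      using m2[of s] S by fastforce
  qed (use m1 S in \<open>auto simp: T_def\<close>)
  show "S \<inter> (\<lambda>(r, B). merge r Q B) ` T = {}"
    using m3 S by (fastforce simp: T_def)
  show "inj_on (\<lambda>(r, B). merge r Q B) T"
  proof (rule inj_onI, clarify)
    fix r B r' B' assume "(r, B) \<in> T" "(r', B') \<in> T" and eq: "merge r Q B = merge r' Q B'"
    then have a: "r \<in> S" "B \<in> subblocks r (C - Q)" "r' \<in> S" "B' \<in> subblocks r' (C - Q)"
      by (auto simp: T_def)
    then have r: "r \<in> interval X q p" "Q \<in> r" "r' \<in> interval X q p" "Q \<in> r'" using S by auto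
    note B = Q_disjoint[OF r(1,2) a(2)] and B' = Q_disjoint[OF r(3,4) a(4)]
    have pr: "partition_on X r" "partition_on X r'" using r by (auto simp: interval_def refines_def)
    have pm: "partition_on X (merge r Q B)" using m1[OF a(1,2)] by (auto simp: interval_def refines_def)
    \<comment> \<open>The block of the merged partition through a point of \<open>Q\<close> is both
      \<open>Q \<union> B\<close> and \<open>Q \<union> B'\<close>. Since \<open>B\<close> and
      \<open>B'\<close> are disjoint from \<open>Q\<close>, they agree, and \<open>r\<close> is then
      recovered by undoing the merge.\<close>
    obtain x where "x \<in> Q" using Q_nonempty by auto
    moreover have "Q \<union> B \<in> merge r Q B" by (simp add: merge_def)
    moreover have "Q \<union> B' \<in> merge r Q B" unfolding eq by (simp add: merge_def)
    ultimately have QB: "Q \<union> B = Q \<union> B'" using partition_on_block_eqI[OF pm] by blast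
    then have BB: "B = B'" using B B' by blast
    have rec: "r = insert Q (insert B (merge r Q B - {Q \<union> B}))" if "partition_on X r" "Q \<in> r" "B \<in> r" "B \<noteq> Q" for r
      using that union_notin_partition[of X r Q B] by (auto simp: merge_def)
    have "r = insert Q (insert B (merge r Q B - {Q \<union> B}))" using rec[OF pr(1) r(2) B(1) B(4)] .
    also have "merge r Q B = merge r' Q B" using eq BB by simp
    also have "insert Q (insert B (merge r' Q B - {Q \<union> B})) = r'"
      using rec[OF pr(2) r(4)] B'(1,4) BB by simp
    finally show "r = r' \<and> B = B'" using BB by simp
  qed
qed

text \<open>\<open>Q\<close> is a single block of \<open>q\<close>, so its weight is 1, and
  \<open>Q \<union> B\<close> contains exactly one more block of \<open>q\<close> than
  \<open>B\<close>. Only this factor changes, by the recurrence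
  \<open>block_weight_Suc\<close>.\<close>

lemma prod_block_weight_merge:
  assumes "r \<in> interval X q p" "Q \<in> r" "B \<in> subblocks r (C - Q)"
  shows "(\<Prod>D\<in>merge r Q B. block_weight (card (subblocks q D))) =
    - real (card (subblocks q B)) * (\<Prod>D\<in>r. block_weight (card (subblocks q D)))"
proof -
  let ?w = "\<lambda>D. block_weight (card (subblocks q D))"
  note B = Q_disjoint[OF assms]
  have qr: "refines X q r" using assms by (simp add: interval_def)
  have pr: "partition_on X r" "partition_on X q" using qr by (auto simp: refines_def)
  have fr: "finite r" "finite q" using finite_refines[OF fin qr] by auto
  have disj: "D = Q \<or> D \<inter> Q = {}" if "D \<in> q" for D
    using that Q(1) partition_on_block_eqI[OF pr(2)] by blast
  have ne: "D \<noteq> {}" if "D \<in> q" for D using that pr partition_onD3 by auto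
  have wQ: "?w Q = 1" by (simp add: block_weight_def subblocks_self[OF pr(2) Q(1)])
  have "subblocks q (Q \<union> B) = insert Q (subblocks q B)"
    using disj Q(1) by (fastforce simp: subblocks_def)
  moreover have "Q \<notin> subblocks q B" using B ne[OF Q(1)] by (auto simp: subblocks_def)
  ultimately have "card (subblocks q (Q \<union> B)) = Suc (card (subblocks q B))"
    using fr by (simp add: subblocks_def)
  then have wQB: "?w (Q \<union> B) = - real (card (subblocks q B)) * ?w B"
    using block_weight_Suc card_subblocks_pos[OF fin qr B(1)] by simp
  have "(\<Prod>D\<in>merge r Q B. ?w D) = ?w (Q \<union> B) * (\<Prod>D\<in>r - {Q, B}. ?w D)"
    using fr union_notin_partition[OF pr(1) assms(2) B(1)] B(4) by (simp add: merge_def)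
  moreover have "(\<Prod>D\<in>r. ?w D) = ?w Q * (?w B * (\<Prod>D\<in>r - {Q, B}. ?w D))"
  proof -
    have "r = insert Q (insert B (r - {Q, B}))" using assms B by auto
    then have "(\<Prod>D\<in>r. ?w D) = (\<Prod>D\<in>insert Q (insert B (r - {Q, B})). ?w D)" by simp
    then show ?thesis using fr B(4) by simp
  qed
  ultimately show ?thesis using wQ wQB by simp
qed

text \<open>Let \<open>k\<close> be the number of \<open>q\<close>-blocks in \<open>C\<close>. Each
  \<open>r\<close> with \<open>Q\<close> as a block contributes its own weight once, and the
  reattachments of \<open>Q\<close> contribute \<open>-(k - 1)\<close> times that weight. This gives
  the factor \<open>1 - (k - 1) = 2 - k\<close>.\<close>

lemma sum_prod_block_weight_split:
  "(\<Sum>r\<in>interval X q p. \<Prod>D\<in>r. block_weight (card (subblocks q D))) =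
    (2 - real (card (subblocks q C))) *
    (\<Sum>r\<in>interval X q (split_block p C Q). \<Prod>D\<in>r. block_weight (card (subblocks q D)))"
proof -
  let ?W = "\<lambda>r. \<Prod>D\<in>r. block_weight (card (subblocks q D))"
  let ?S = "interval X q (split_block p C Q)"
  let ?T = "SIGMA r:?S. subblocks r (C - Q)"
  have S: "r \<in> interval X q p" "Q \<in> r" if "r \<in> ?S" for r
    using that unfolding interval_split_block by auto
  have finS: "finite ?S" using finite_interval[OF fin] .
  have finB: "finite (subblocks r (C - Q))" if "r \<in> ?S" for r
    using that finite_refines[OF fin] by (auto simp: interval_def subblocks_def)
  then have finT: "finite ?T" using finS by auto
  have k: "(\<Sum>B\<in>subblocks r (C - Q). real (card (subblocks q B))) = real (card (subblocks q C)) - 1"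
    if r: "r \<in> ?S" for r
  proof -
    \<comment> \<open>\<open>C - Q\<close> is a block of the split partition, so the blocks of
      \<open>r\<close> inside it partition it and together contain all \<open>q\<close>-blocks of
      \<open>C\<close> except \<open>Q\<close>.\<close>
    have "refines (C - Q) (subblocks q (C - Q)) (subblocks r (C - Q))"
      by (rule refines_subblocks) (use r in \<open>auto simp: interval_def split_block_def\<close>)
    then have "(\<Sum>B\<in>subblocks r (C - Q). card (subblocks (subblocks q (C - Q)) B)) = card (subblocks q (C - Q))"
      by (rule sum_card_subblocks[rotated])
        (use fin C qp partition_onD1[of X p] in \<open>auto simp: refines_def intro: finite_subset[OF _ fin]\<close>)
    moreover have "subblocks (subblocks q (C - Q)) B = subblocks q B" if "B \<in> subblocks r (C - Q)" for B
      using that by (auto simp: subblocks_def)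
    ultimately have 1: "(\<Sum>B\<in>subblocks r (C - Q). card (subblocks q B)) = card (subblocks q (C - Q))"
      by (simp cong: sum.cong)
    have "D = Q \<or> D \<inter> Q = {}" if "D \<in> q" for D
      using that Q(1) qp partition_on_block_eqI[of X q] by (auto simp: refines_def)
    then have "subblocks q C = insert Q (subblocks q (C - Q))"
      using Q by (auto simp: subblocks_def)
    moreover have "Q \<notin> subblocks q (C - Q)"
      using Q_nonempty by (auto simp: subblocks_def)
    moreover have "finite (subblocks q (C - Q))"
      using finite_refines[OF fin qp] by (simp add: subblocks_def)
    ultimately have "card (subblocks q C) = Suc (card (subblocks q (C - Q)))" by simp
    then show ?thesis using 1 by (simp flip: of_nat_sum)
  qed
  note dec = interval_merge_decomposition
  have "(\<Sum>r\<in>interval X q p. ?W r) = (\<Sum>r\<in>?S. ?W r) + (\<Sum>s\<in>(\<lambda>(r, B). merge r Q B) ` ?T. ?W s)"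
    unfolding dec(1) by (rule sum.union_disjoint) (use finS finT dec(2) in auto)
  also have "(\<Sum>s\<in>(\<lambda>(r, B). merge r Q B) ` ?T. ?W s) = (\<Sum>(r, B)\<in>?T. ?W (merge r Q B))"
    by (subst sum.reindex[OF dec(3)]) (simp add: case_prod_unfold)
  also have "\<dots> = (\<Sum>r\<in>?S. \<Sum>B\<in>subblocks r (C - Q). ?W (merge r Q B))"
    by (rule sum.Sigma[symmetric]) (use finS finB in auto)
  also have "\<dots> = (\<Sum>r\<in>?S. (1 - real (card (subblocks q C))) * ?W r)"
  proof (rule sum.cong[OF refl])
    fix r assume r: "r \<in> ?S"
    have "(\<Sum>B\<in>subblocks r (C - Q). ?W (merge r Q B)) =
        (\<Sum>B\<in>subblocks r (C - Q). - real (card (subblocks q B)) * ?W r)"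
      using prod_block_weight_merge S[OF r] by (intro sum.cong) auto
    also have "\<dots> = - (\<Sum>B\<in>subblocks r (C - Q). real (card (subblocks q B))) * ?W r"
      by (simp only: mult_minus_left sum_negf sum_distrib_right)
    finally show "(\<Sum>B\<in>subblocks r (C - Q). ?W (merge r Q B)) = (1 - real (card (subblocks q C))) * ?W r"
      using k[OF r] by simp
  qed
  also have "(\<Sum>r\<in>?S. ?W r) + \<dots> = (2 - real (card (subblocks q C))) * (\<Sum>r\<in>?S. ?W r)"
    by (simp add: left_diff_distrib sum_subtractf flip: sum_distrib_left)
  finally show ?thesis .
qed

text \<open>Merging \<open>Q\<close> and \<open>C - Q\<close> again gives back \<open>p\<close>. The
  count makes the induction measure in \<open>sum_mu_f_bottom\<close> decrease.\<close>

lemma card_split_block: "card (split_block p C Q) = Suc (card p)"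
proof -
  have p: "partition_on X p" using qp by (simp add: refines_def)
  have *: "D \<notin> p" if "D \<subset> C" "D \<noteq> {}" for D
    using that C p partition_on_block_eqI[of X p D C] by blast
  have "Q \<union> C = C" using Q by auto
  then have "merge (split_block p C Q) Q (C - Q) = p"
    using Q C *[of Q] *[of "C - Q"] Q_nonempty by (auto simp: merge_def split_block_def)
  moreover have "Q \<noteq> C - Q" using Q_nonempty by auto
  moreover have "partition_on X (split_block p C Q)" using refines_splits by (simp add: refines_def)
  moreover have "Q \<in> split_block p C Q" "C - Q \<in> split_block p C Q" by (auto simp: split_block_def)
  ultimately show ?thesis
    using card_merge[OF fin] by metis
qed

end

text \<open>Induction on \<open>card q - card p\<close>. With \<open>k \<ge> 2\<close> blocks of
  \<open>q\<close> in \<open>C\<close>, detaching one of them produces the factor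
  \<open>2 - k\<close>. It vanishes for \<open>k = 2\<close>; for larger \<open>k\<close> the split
  partition still differs from \<open>q\<close>, and its sum vanishes by induction.\<close>

lemma sum_mu_f_bottom:
  assumes "finite X" "refines X q p"
  shows "(\<Sum>r\<in>interval X q p. mu_f q r) = of_bool (q = p)"
proof -
  let ?W = "\<lambda>r. \<Prod>D\<in>r. block_weight (card (subblocks q D))"
  have mu: "(\<Sum>r\<in>interval X q p. mu_f q r) = (\<Sum>r\<in>interval X q p. ?W r)" for p
    by (rule sum.cong) (auto simp: interval_def mu_f_eq_prod[OF assms(1)])
  show ?thesis
  proof (cases "q = p")
    case True
    then have "interval X q p = {q}"
      using assms refines_asym by (auto simp: interval_def)
    then show ?thesis
      using True assms mu_f_eq_prod[OF assms]
      by (simp add: refines_def subblocks_self[of X] block_weight_def)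
  next
    case False
    have "(\<Sum>r\<in>interval X q p. ?W r) = 0"
      using assms(2) False
    proof (induction "card q - card p" arbitrary: p rule: less_induct)
      case less
      obtain C where C: "C \<in> p" "2 \<le> card (subblocks q C)"
        using refines_neq_ex_block[OF assms(1) less.prems] by blast
      then have "subblocks q C \<noteq> {}" by auto
      then obtain Q where Q: "Q \<in> q" "Q \<subseteq> C" by (auto simp: subblocks_def)
      have pq: "partition_on X q" using less.prems by (simp add: refines_def)
      have "Q \<noteq> C"
        using subblocks_self[OF pq Q(1)] C(2) by auto
      then have QC: "Q \<subset> C" using Q by auto
      note split = sum_prod_block_weight_split[OF assms(1) less.prems(1) C(1) Q(1) QC]
      show ?case
      proof (cases "card (subblocks q C) = 2")
        case True
        then show ?thesis using split by simp
      next
        case neq: False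
        let ?p = "split_block p C Q"
        note rs = refines_splits[OF assms(1) less.prems(1) C(1) Q(1) QC]
        have cp: "card ?p = Suc (card p)"
          using card_split_block[OF assms(1) less.prems(1) C(1) Q(1) QC] .
        \<comment> \<open>If \<open>q\<close> were the split partition, \<open>C\<close> would
          contain only the \<open>q\<close>-blocks \<open>Q\<close> and \<open>C - Q\<close>, which
          is the excluded case of two blocks.\<close>
        have "q \<noteq> ?p"
        proof
          assume "q = ?p"
          then have "C - Q \<in> q" by (auto simp: split_block_def)
          then have "subblocks q (C - Q) = {C - Q}" using subblocks_self[OF pq] by blast
          moreover have "D = Q \<or> D \<inter> Q = {}" if "D \<in> q" for D
            using that Q(1) partition_on_block_eqI[OF pq] by blast
          ultimately have "D = Q \<or> D = C - Q" if "D \<in> subblocks q C" for D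
            using that by (fastforce simp: subblocks_def)
          then have "subblocks q C \<subseteq> {Q, C - Q}" by auto
          then have "card (subblocks q C) \<le> card {Q, C - Q}" by (intro card_mono) auto
          also have "\<dots> \<le> 2" by (simp add: card_insert_if)
          finally show False using C neq by simp
        qed
        moreover have "card ?p \<le> card q" using refines_card_le[OF assms(1) rs(1)] .
        ultimately have "(\<Sum>r\<in>interval X q ?p. ?W r) = 0"
          using less.hyps[of ?p] rs(1) cp by simp
        then show ?thesis using split by simp
      qed
    qed
    then show ?thesis using mu[of p] False by simp
  qed
qed

section \<open>Inverse matrices for refinement and its suborders\<close>

lemma sum_eq_single:
  fixes f :: "'i \<Rightarrow> real"
  assumes "finite I" "m \<in> I" "\<And>z. z \<in> I \<Longrightarrow> z \<noteq> m \<Longrightarrow> f z = 0"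
  shows "(\<Sum>z\<in>I. f z) = f m"
  using assms by (subst sum.remove[of I m]) (auto intro!: sum.neutral)

lemma finite_partitions: "finite X \<Longrightarrow> finite (partitions X)"
  unfolding partitions_def by (rule finitely_many_partition_on)

lemma refines_partitionsD: "refines X q p \<Longrightarrow> q \<in> partitions X \<and> p \<in> partitions X"
  by (simp add: refines_def partitions_def)

text \<open>Among the partitions where \<open>v\<close> is nonzero, take \<open>y\<close> with the
  most blocks. Any other partition finer than \<open>y\<close> has more blocks, so the equation at
  \<open>y\<close> reduces to \<open>v y = 0\<close>.\<close>

lemma refines_zeta_injective:
  fixes v :: "'a set set \<Rightarrow> real"
  assumes "finite X"
    and eq: "\<And>y. y \<in> partitions X \<Longrightarrow> (\<Sum>x\<in>partitions X. v x * of_bool (refines X x y)) = 0"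
    and "x \<in> partitions X"
  shows "v x = 0"
proof (rule ccontr)
  let ?S = "{x \<in> partitions X. v x \<noteq> 0}"
  assume "v x \<noteq> 0"
  then have "?S \<noteq> {}" using assms(3) by auto
  moreover have fS: "finite ?S" using finite_partitions[OF assms(1)] by simp
  ultimately have "Max (card ` ?S) \<in> card ` ?S" by (intro Max_in) auto
  then obtain y where y: "y \<in> partitions X" "v y \<noteq> 0" and "Max (card ` ?S) = card y" by auto
  then have max: "card z \<le> card y" if "z \<in> partitions X" "v z \<noteq> 0" for z
    using that fS Max_ge[of "card ` ?S" "card z"] by auto
  have "v z * of_bool (refines X z y) = 0" if "z \<in> partitions X" "z \<noteq> y" for z
    using that max[of z] refines_card_le[OF assms(1), of z y] refines_card_eq[OF assms(1), of z y] by auto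
  then have "(\<Sum>x\<in>partitions X. v x * of_bool (refines X x y)) = v y * of_bool (refines X y y)"
    by (intro sum_eq_single finite_partitions assms(1) y(1))
  moreover have "refines X y y" using y(1) refines_refl by (auto simp: partitions_def)
  ultimately have "(\<Sum>x\<in>partitions X. v x * of_bool (refines X x y)) = v y" by simp
  then show False using eq[OF y(1)] y(2) by simp
qed

lemma sum_interval_conv:
  assumes "finite X"
  shows "(\<Sum>z\<in>partitions X. of_bool (refines X q z) * of_bool (refines X z p) * f z) =
    (\<Sum>z\<in>interval X q p. f z :: real)"
proof -
  have "(\<Sum>z\<in>interval X q p. f z) =
      (\<Sum>z\<in>interval X q p. of_bool (refines X q z) * of_bool (refines X z p) * f z)"
    by (rule sum.cong) (auto simp: interval_def)
  also have "\<dots> = (\<Sum>z\<in>partitions X. of_bool (refines X q z) * of_bool (refines X z p) * f z)"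
    by (rule sum.mono_neutral_left)
      (auto simp: finite_partitions[OF assms] interval_def dest: refines_partitionsD)
  finally show ?thesis by simp
qed

text \<open>\<open>mu_f\<close> is a left inverse \<open>M\<close> of the zeta matrix \<open>Z\<close> of refinement. Since \<open>Z\<close> is
  injective on row vectors, \<open>(Z M - 1) Z = 0\<close> makes \<open>M\<close> a right inverse as well.\<close>

lemma sum_mu_f_top:
  assumes "finite X" "refines X q p"
  shows "(\<Sum>r\<in>interval X q p. mu_f r p) = of_bool (q = p)"
proof -
  let ?I = "partitions X"
  let ?Z = "\<lambda>x y. of_bool (refines X x y) :: real"
  define M where "M x y = ?Z x y * mu_f x y" for x y
  define W where "W x y = (\<Sum>z\<in>?I. ?Z x z * M z y)" for x y
  have fin: "finite ?I" using finite_partitions[OF assms(1)] .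
  have MZ: "(\<Sum>z\<in>?I. M x z * ?Z z y) = of_bool (x = y)" if "x \<in> ?I" for x y
  proof -
    have "(\<Sum>z\<in>?I. M x z * ?Z z y) = (\<Sum>z\<in>interval X x y. mu_f x z)"
      unfolding sum_interval_conv[OF assms(1), symmetric] by (simp add: M_def mult_ac)
    also have "\<dots> = of_bool (x = y)"
    proof (cases "refines X x y")
      case False
      then have "interval X x y = {}" using refines_trans by (auto simp: interval_def)
      then show ?thesis using False that refines_refl by (auto simp: partitions_def)
    qed (use sum_mu_f_bottom[OF assms(1)] in simp)
    finally show ?thesis .
  qed
  have q: "q \<in> ?I" and p: "p \<in> ?I" using assms(2) refines_partitionsD by auto
  \<comment> \<open>\<open>W\<close> is the product \<open>Z M\<close>; the vector shown to vanish
    is the row of \<open>Z M - 1\<close> at \<open>q\<close>.\<close>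
  have "W q p - of_bool (q = p) = 0"
  proof (rule refines_zeta_injective[OF assms(1) _ p, of "\<lambda>x. W q x - of_bool (q = x)"])
    fix y assume y: "y \<in> ?I"
    \<comment> \<open>Associativity: \<open>(Z M) Z = Z (M Z) = Z\<close>.\<close>
    have "(\<Sum>x\<in>?I. W q x * ?Z x y) = (\<Sum>z\<in>?I. ?Z q z * (\<Sum>x\<in>?I. M z x * ?Z x y))"
      unfolding W_def sum_distrib_left sum_distrib_right
      by (subst sum.swap) (simp only: mult.assoc)
    also have "\<dots> = (\<Sum>z\<in>?I. ?Z q z * of_bool (z = y))"
      by (rule sum.cong) (simp_all only: MZ)
    also have "\<dots> = ?Z q y"
      by (subst sum_eq_single[OF fin y]) auto
    also have "\<dots> = (\<Sum>x\<in>?I. of_bool (q = x) * ?Z x y)"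
      by (subst sum_eq_single[OF fin q]) auto
    finally show "(\<Sum>x\<in>?I. (W q x - of_bool (q = x)) * ?Z x y) = 0"
      by (simp add: left_diff_distrib sum_subtractf)
  qed
  moreover have "W q p = (\<Sum>r\<in>interval X q p. mu_f r p)"
    unfolding W_def sum_interval_conv[OF assms(1), symmetric] by (simp add: M_def mult_ac)
  ultimately show ?thesis by simp
qed

text \<open>By convexity, an interval of \<open>R\<close> between \<open>R\<close>-related
  partitions equals the refinement interval, so both sums of \<open>mu_f\<close> carry over. If the
  endpoints are not \<open>R\<close>-related, transitivity kills every term, and reflexivity makes
  the endpoints distinct.\<close>

lemma is_inverse_matrix_suborder:
  assumes "finite X"
    and R_refines: "\<And>q p. R q p \<Longrightarrow> refines X q p"
    and R_refl: "\<And>p. p \<in> partitions X \<Longrightarrow> R p p"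
    and R_trans: "\<And>q r p. R q r \<Longrightarrow> R r p \<Longrightarrow> R q p"
    and R_convex: "\<And>q r p. R q p \<Longrightarrow> refines X q r \<Longrightarrow> refines X r p \<Longrightarrow> R q r \<and> R r p"
  shows "is_inverse_matrix (partitions X) (\<lambda>x y. of_bool (R x y)) (\<lambda>x y. of_bool (R x y) * mu_f x y)"
proof -
  have *: "(\<Sum>z\<in>partitions X. of_bool (R x z) * of_bool (R z y) * f z) =
      (if R x y then \<Sum>z\<in>interval X x y. f z else 0)" for x y and f :: "_ \<Rightarrow> real"
  proof (cases "R x y")
    case True
    then have "of_bool (R x z) * of_bool (R z y) * f z =
        of_bool (refines X x z) * of_bool (refines X z y) * f z" for z
      using R_convex[OF True, of z] R_refines[of x z] R_refines[of z y] by auto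
    then show ?thesis using True by (simp only: sum_interval_conv[OF assms(1)] if_True)
  next
    case False
    then show ?thesis using R_trans by (auto intro!: sum.neutral)
  qed
  have neq: "x \<noteq> y" if "\<not> R x y" "x \<in> partitions X" for x y using that R_refl by auto
  show ?thesis
    unfolding is_inverse_matrix_def
  proof (intro conjI ballI allI impI)
    fix x y assume xy: "x \<in> partitions X" "y \<in> partitions X"
    have "(\<Sum>z\<in>partitions X. of_bool (R x z) * (of_bool (R z y) * mu_f z y)) =
        (if R x y then \<Sum>z\<in>interval X x y. mu_f z y else 0)"
      using *[of x y "\<lambda>z. mu_f z y"] by (simp only: mult.assoc)
    then show "(\<Sum>z\<in>partitions X. of_bool (R x z) * (of_bool (R z y) * mu_f z y)) = of_bool (x = y)"
      using sum_mu_f_top[OF assms(1) R_refines] neq[of x y] xy by simp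
    have "(\<Sum>z\<in>partitions X. of_bool (R x z) * mu_f x z * of_bool (R z y)) =
        (if R x y then \<Sum>z\<in>interval X x y. mu_f x z else 0)"
      using *[of x y "\<lambda>z. mu_f x z"] by (simp only: mult_ac)
    then show "(\<Sum>z\<in>partitions X. of_bool (R x z) * mu_f x z * of_bool (R z y)) = of_bool (x = y)"
      using sum_mu_f_bottom[OF assms(1) R_refines] neq[of x y] xy by simp
  next
    fix x y assume "x \<notin> partitions X \<or> y \<notin> partitions X"
    then show "of_bool (R x y) * mu_f x y = 0"
      using R_refines refines_partitionsD by fastforce
  qed
qed

text \<open>Serves the finer-compatible order, whose matrix enters the factorization with the
  coarser partition as row index.\<close>

lemma is_inverse_matrix_transpose:
  assumes "is_inverse_matrix I M N"
  shows "is_inverse_matrix I (\<lambda>x y. M y x) (\<lambda>x y. N y x)"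
  unfolding is_inverse_matrix_def
proof (intro conjI ballI)
  fix x y assume xy: "x \<in> I" "y \<in> I"
  show "(\<Sum>z\<in>I. M z x * N y z) = of_bool (x = y)"
    using assms xy unfolding is_inverse_matrix_def by (subst mult.commute) auto
  show "(\<Sum>z\<in>I. N z x * M y z) = of_bool (x = y)"
    using assms xy unfolding is_inverse_matrix_def by (subst mult.commute) auto
qed (use assms in \<open>auto simp: is_inverse_matrix_def\<close>)

lemma is_inverse_matrix_cong:
  assumes "is_inverse_matrix I M N" "\<And>x y. x \<in> I \<Longrightarrow> y \<in> I \<Longrightarrow> M x y = M' x y"
  shows "is_inverse_matrix I M' N"
  using assms by (auto simp: is_inverse_matrix_def cong: sum.cong)

section \<open>Factorization of the geodesic order\<close>

text \<open>\<open>(A B) (B' A') = A (B B') A' = A A'\<close>, evaluated at one entry. Both sides of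
  the inverse condition in \<open>is_inverse_matrix_mult\<close> are instances of it.\<close>

lemma sum_matrix_mult_cancel:
  fixes A B A' B' :: "'i \<Rightarrow> 'i \<Rightarrow> real"
  assumes "finite I" "x \<in> I"
    and B: "\<And>u v. u \<in> I \<Longrightarrow> v \<in> I \<Longrightarrow> (\<Sum>z\<in>I. B u z * B' z v) = of_bool (u = v)"
    and A: "(\<Sum>z\<in>I. A x z * A' z y) = of_bool (x = y)"
  shows "(\<Sum>z\<in>I. (\<Sum>u\<in>I. A x u * B u z) * (\<Sum>v\<in>I. B' z v * A' v y)) = of_bool (x = y)"
proof -
  have "(\<Sum>z\<in>I. (\<Sum>u\<in>I. A x u * B u z) * (\<Sum>v\<in>I. B' z v * A' v y)) =
      (\<Sum>z\<in>I. \<Sum>u\<in>I. \<Sum>v\<in>I. A x u * (B u z * B' z v) * A' v y)"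
    by (simp only: sum_product mult.assoc)
  also have "\<dots> = (\<Sum>u\<in>I. \<Sum>v\<in>I. \<Sum>z\<in>I. A x u * (B u z * B' z v) * A' v y)"
    by (subst sum.swap) (intro sum.cong refl sum.swap)
  also have "\<dots> = (\<Sum>u\<in>I. \<Sum>v\<in>I. A x u * (\<Sum>z\<in>I. B u z * B' z v) * A' v y)"
    by (simp only: sum_distrib_left sum_distrib_right)
  also have "\<dots> = (\<Sum>u\<in>I. \<Sum>v\<in>I. A x u * of_bool (u = v) * A' v y)"
    by (intro sum.cong refl) (simp only: B)
  also have "\<dots> = (\<Sum>u\<in>I. A x u * A' u y)"
  proof (rule sum.cong[OF refl])
    fix u assume "u \<in> I"
    then show "(\<Sum>v\<in>I. A x u * of_bool (u = v) * A' v y) = A x u * A' u y"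
      by (subst sum_eq_single[OF assms(1)]) auto
  qed
  finally show ?thesis using A by simp
qed

lemma is_inverse_matrix_mult:
  assumes "finite I" "is_inverse_matrix I A A'" "is_inverse_matrix I B B'"
  shows "is_inverse_matrix I (\<lambda>x y. \<Sum>z\<in>I. A x z * B z y) (\<lambda>x y. \<Sum>z\<in>I. B' x z * A' z y)"
  using assms(2,3) unfolding is_inverse_matrix_def
  by (intro conjI ballI sum_matrix_mult_cancel[OF assms(1)]) (auto intro!: sum.neutral)

lemma pmeet_greatest:
  assumes "partition_on X p" "partition_on X p'"
  shows "refines X (pmeet X p p') p" "refines X (pmeet X p p') p'"
    and "refines X r p \<Longrightarrow> refines X r p' \<Longrightarrow> refines X r (pmeet X p p')"
proof -
  note eq = pmeet_eq_common_refinement[OF assms]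
  show "refines X (pmeet X p p') p" "refines X (pmeet X p p') p'"
    unfolding eq by (rule refines_common_refinement; use assms in auto)+
  show "refines X r (pmeet X p p')" if "refines X r p" "refines X r p'"
    unfolding eq by (rule common_refinement_coarsest) (use assms that in \<open>auto simp: refines_def\<close>)
qed

section \<open>The compatibility orders over a fixed base partition\<close>

context
  fixes X :: "'a set" and b :: "'a set set"
  assumes fin: "finite X" and b: "partition_on X b"
begin

lemma card_pjoin_antimono:
  assumes "refines X q p"
  shows "card (pjoin X p b) \<le> card (pjoin X q b)"
  using refines_card_le[OF fin pjoin_mono[OF assms b]] .

text \<open>Convexity: the number of blocks of the join with \<open>b\<close> cannot grow under
  coarsening, so equal values at the ends force the same value in between.\<close>

lemma is_inverse_matrix_coarser_compat:
  "is_inverse_matrix (partitions X) (\<lambda>x y. of_bool (coarser_compat X b y x))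
    (\<lambda>x y. of_bool (coarser_compat X b y x) * mu_f x y)"
proof (rule is_inverse_matrix_suborder[OF fin])
  fix q r p assume "coarser_compat X b p q" and r: "refines X q r" "refines X r p"
  then show "coarser_compat X b r q \<and> coarser_compat X b p r"
    using card_pjoin_antimono[OF r(1)] card_pjoin_antimono[OF r(2)] by (simp add: coarser_compat_def)
next
  show "coarser_compat X b p q" if "coarser_compat X b r q" "coarser_compat X b p r" for q r p
    using that refines_trans[of X q r p] by (simp add: coarser_compat_def)
qed (auto simp: coarser_compat_def partitions_def refines_refl)

text \<open>Convexity: by semimodularity \<open>nc r - nc (pjoin X r b)\<close> cannot grow when
  \<open>r\<close> becomes coarser, so equal values at the ends force the same value in
  between.\<close>

lemma is_inverse_matrix_finer_compat:
  "is_inverse_matrix (partitions X) (\<lambda>x y. of_bool (finer_compat X b x y))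
    (\<lambda>x y. of_bool (finer_compat X b x y) * mu_f x y)"
proof (rule is_inverse_matrix_suborder[OF fin])
  fix q r p assume "finer_compat X b q p" and r: "refines X q r" "refines X r p"
  then show "finer_compat X b q r \<and> finer_compat X b r p"
    using refines_join_semimodular[OF fin b r(1)] refines_join_semimodular[OF fin b r(2)]
    by (simp add: finer_compat_def)
next
  show "finer_compat X b q p" if "finer_compat X b q r" "finer_compat X b r p" for q r p
    using that refines_trans[of X q r p] by (simp add: finer_compat_def)
qed (auto simp: finer_compat_def partitions_def refines_refl)

lemma geodesic_le_iff:
  assumes "partition_on X p" "partition_on X p'"
  shows "geodesic_le X b p' p \<longleftrightarrow>
    coarser_compat X b (pjoin X p' p) p \<and> finer_compat X b p' (pjoin X p' p)"
proof -
  let ?j = "pjoin X p' p"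
  have j: "refines X p' ?j" "refines X p ?j"
    using pjoin_eq_common_refinement[OF assms(2,1)] by auto
  have 1: "card (pjoin X ?j b) \<le> card (pjoin X p b)" using card_pjoin_antimono[OF j(2)] .
  have 2: "card ?j + card (pjoin X p' b) \<le> card p' + card (pjoin X ?j b)"
    using refines_join_semimodular[OF fin b j(1)] .
  \<comment> \<open>The halves of \<open>nc b\<close> and \<open>nc p\<close> cancel, and the two
    halves of \<open>nc p'\<close> add up.\<close>
  have "geodesic_le X b p' p \<longleftrightarrow>
      real (card p') + real (card (pjoin X p b)) = real (card (pjoin X p' b)) + real (card ?j)"
    unfolding geodesic_le_def pdist_def pjoin_commute[of X b] by (auto simp: field_simps)
  also have "\<dots> \<longleftrightarrow> card p' + card (pjoin X p b) = card (pjoin X p' b) + card ?j"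
    by linarith
  also have "\<dots> \<longleftrightarrow> coarser_compat X b ?j p \<and> finer_compat X b p' ?j"
    unfolding coarser_compat_def finer_compat_def using 1 2 j by auto
  finally show ?thesis .
qed

text \<open>The join \<open>j\<close> is finer than \<open>z\<close>, so
  \<open>card z \<le> card j\<close>. Conversely, semimodularity from \<open>p'\<close> to
  \<open>j\<close>, together with
  \<open>nc (pjoin X j b) \<le> nc (pjoin X p b) = nc (pjoin X z b)\<close>, gives
  \<open>card j \<le> card z\<close>.\<close>

lemma compat_join_unique:
  assumes "finer_compat X b p' z" "coarser_compat X b z p"
  shows "z = pjoin X p' p"
proof -
  let ?j = "pjoin X p' p"
  have z: "refines X p' z" "refines X p z"
    using assms by (auto simp: finer_compat_def coarser_compat_def)
  then have p: "partition_on X p'" "partition_on X p" by (auto simp: refines_def)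
  have j: "refines X p' ?j" "refines X p ?j" "refines X ?j z"
    using pjoin_eq_common_refinement[OF p] z by auto
  have "card ?j = card z"
    using assms refines_card_le[OF fin j(3)] card_pjoin_antimono[OF j(2)] card_pjoin_antimono[OF j(3)]
      refines_join_semimodular[OF fin b j(1)]
    by (simp add: finer_compat_def coarser_compat_def)
  then show ?thesis using refines_card_eq[OF fin j(3)] by simp
qed

text \<open>Dually, \<open>z\<close> refines the meet \<open>m\<close>, so
  \<open>card m \<le> card z\<close>. Semimodularity from \<open>m\<close> to \<open>p\<close>,
  together with \<open>nc (pjoin X m b) \<ge> nc (pjoin X p' b) = nc (pjoin X z b)\<close>, gives
  the converse inequality.\<close>

lemma compat_meet_unique:
  assumes "coarser_compat X b p' z" "finer_compat X b z p"
  shows "z = pmeet X p' p"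
proof -
  let ?m = "pmeet X p' p"
  have z: "refines X z p'" "refines X z p"
    using assms by (auto simp: finer_compat_def coarser_compat_def)
  then have p: "partition_on X p'" "partition_on X p" by (auto simp: refines_def)
  have m: "refines X ?m p'" "refines X ?m p" "refines X z ?m"
    using pmeet_greatest[OF p] z by auto
  have "card z = card ?m"
    using assms refines_card_le[OF fin m(3)] card_pjoin_antimono[OF m(1)] card_pjoin_antimono[OF m(3)]
      refines_join_semimodular[OF fin b m(2)]
    by (simp add: finer_compat_def coarser_compat_def)
  then show ?thesis using refines_card_eq[OF fin m(3)] by simp
qed

lemma order_matrix_geodesic_factorization:
  assumes "x \<in> partitions X" "y \<in> partitions X"
  shows "(\<Sum>z\<in>partitions X. of_bool (coarser_compat X b z x) * of_bool (finer_compat X b y z)) =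
    order_matrix (geodesic_le X b) x y"
proof -
  have p: "partition_on X x" "partition_on X y" using assms by (auto simp: partitions_def)
  have "pjoin X y x \<in> partitions X"
    using pjoin_eq_common_refinement(2)[OF p(2,1)] refines_partitionsD by blast
  then have "(\<Sum>z\<in>partitions X. of_bool (coarser_compat X b z x) * of_bool (finer_compat X b y z) :: real) =
      of_bool (coarser_compat X b (pjoin X y x) x) * of_bool (finer_compat X b y (pjoin X y x))"
    by (rule sum_eq_single[OF finite_partitions[OF fin]]) (use compat_join_unique in auto)
  then show ?thesis by (simp add: order_matrix_def geodesic_le_iff[OF p])
qed

end

theorem theorem2p6:
  fixes X :: "'a set" and b p1 p2 :: "'a set set"
  assumes "finite X"
    and "b \<in> partitions X"
    and "p1 \<in> partitions X"
    and "p2 \<in> partitions X"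
  shows "moebius (partitions X) (geodesic_le X b) p1 p2 =
    of_bool (coarser_compat X b p1 (pmeet X p1 p2)) *
    of_bool (finer_compat X b (pmeet X p1 p2) p2) *
    mu_f (pmeet X p1 p2) p1 * mu_f (pmeet X p1 p2) p2"
proof -
  let ?I = "partitions X" and ?m = "pmeet X p1 p2"
  have b: "partition_on X b" and p: "partition_on X p1" "partition_on X p2"
    using assms by (auto simp: partitions_def)
  have fin: "finite ?I" using finite_partitions[OF assms(1)] .
  let ?N = "\<lambda>x y. \<Sum>z\<in>?I. (of_bool (finer_compat X b z x) * mu_f z x) *
      (of_bool (coarser_compat X b y z) * mu_f z y)"
  have "is_inverse_matrix ?I (order_matrix (geodesic_le X b)) ?N"
    using is_inverse_matrix_mult[OF fin is_inverse_matrix_coarser_compat[OF assms(1) b]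
        is_inverse_matrix_transpose[OF is_inverse_matrix_finer_compat[OF assms(1) b]]]
    by (rule is_inverse_matrix_cong) (rule order_matrix_geodesic_factorization[OF assms(1) b])
  then have "inverse_matrix ?I (order_matrix (geodesic_le X b)) = ?N"
    by (rule inverse_matrix_eqI[OF fin])
  \<comment> \<open>\<open>moebius\<close> reads the inverse matrix with its arguments exchanged,
    hence row \<open>p2\<close> and column \<open>p1\<close>.\<close>
  then have "moebius ?I (geodesic_le X b) p1 p2 = ?N p2 p1"
    unfolding moebius_def by (rule fun_cong[OF fun_cong])
  also have "\<dots> = (of_bool (finer_compat X b ?m p2) * mu_f ?m p2) *
      (of_bool (coarser_compat X b p1 ?m) * mu_f ?m p1)"
  proof (rule sum_eq_single[OF fin])
    show "?m \<in> ?I" using pmeet_greatest(1)[OF p] refines_partitionsD by blast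
  qed (use compat_meet_unique[OF assms(1) b] in auto)
  finally show ?thesis by (simp only: mult_ac)
qed

end
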